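(* Let $A$ be a Banach algebra, let $\phi\in\Delta(A)$, and let $e\in A$ be an element of the closed unit ball of $A$ with $\phi(e)\neq 0$. If $A$ is $\phi$-biprojective, then $A_e$ is $\psi$-biprojective, where $\psi=\phi(e)\phi$.
   Context: For a Banach algebra $A$ and an element $e$ of the closed unit ball $\overline{B^0_1}$ of $A$ (so $\|e\|\le 1$), $A_e$ denotes the Banach algebra whose underlying Banach space is $A$ and whose product is $a\ast b=aeb$. $\Delta(A)$ denotes the set of all non-zero multiplicative linear functionals on $A$. If $\phi\in\Delta(A)$ and $\phi(e)\neq0$, then $\phi(e)\phi$ (the functional $a\mapsto\phi(e)\phi(a)$) is a non-zero multiplicative linear functional on $A_e$. For a Banach algebra $A$, the projective tensor product $A\otimes_p A$ is a Banach $A$-bimodule via $a\cdot(b\otimes c)=ab\otimes c$ and $(b\otimes c)\cdot a=b\otimes ca$, and $\pi_A:A\otimes_pA\to A$ is the bounded linear map determined by $\pi_A(a\otimes b)=ab$ (for $A_e$ all of these are formed with the product $\ast$). An $A$-bimodule morphism $T:X\to Y$ between Banach $A$-bimodules is a linear map with $T(a\cdot x)=a\cdot T(x)$ and $T(x\cdot a)=T(x)\cdot a$ for all $a\in A$, $x\in X$. For $\phi\in\Delta(A)$, $A$ is called $\phi$-biprojective if there exists a bounded $A$-bimodule morphism $\rho:A\to A\otimes_pA$ such that $\phi\circ\pi_A\circ\rho=\phi$. *)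

theory Defs
  imports "HOL-Analysis.Analysis"
begin

section \<open>Complex Banach spaces\<close>

class scaleC =
  fixes scaleC :: "complex \<Rightarrow> 'a \<Rightarrow> 'a" (infixr "*\<^sub>C" 75)

class complex_vector = scaleR + scaleC + ab_group_add +
  assumes scaleR_scaleC: "r *\<^sub>R x = complex_of_real r *\<^sub>C x"
    and scaleC_add_right: "a *\<^sub>C (x + y) = a *\<^sub>C x + a *\<^sub>C y"
    and scaleC_add_left: "(a + b) *\<^sub>C x = a *\<^sub>C x + b *\<^sub>C x"
    and scaleC_scaleC: "a *\<^sub>C b *\<^sub>C x = (a * b) *\<^sub>C x"
    and scaleC_one: "1 *\<^sub>C x = x"
begin

subclass real_vector
  by unfold_locales
    (simp_all add: scaleR_scaleC scaleC_add_right scaleC_add_left scaleC_scaleC scaleC_one)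

end

class complex_normed_vector = complex_vector + real_normed_vector +
  assumes norm_scaleC: "norm (a *\<^sub>C x) = cmod a * norm x"

class complex_banach = complex_normed_vector + complete_space
begin

subclass banach ..

end

instantiation complex :: complex_banach
begin

definition scaleC_complex :: "complex \<Rightarrow> complex \<Rightarrow> complex" where
  "scaleC_complex a x = a * x"

instance
  by intro_classes (simp_all add: scaleC_complex_def scaleR_conv_of_real algebra_simps norm_mult)

end

lemma vector_space_scaleC: "vector_space (scaleC :: complex \<Rightarrow> 'a \<Rightarrow> 'a::complex_vector)"
  by unfold_locales (simp_all add: scaleC_add_right scaleC_add_left scaleC_scaleC scaleC_one)

abbreviation clinear :: "('a::complex_vector \<Rightarrow> 'b::complex_vector) \<Rightarrow> bool" where
  "clinear \<equiv> Vector_Spaces.linear scaleC scaleC"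

lemma clinear_iff:
  "clinear f \<longleftrightarrow> (\<forall>x y. f (x + y) = f x + f y) \<and> (\<forall>c x. f (c *\<^sub>C x) = c *\<^sub>C f x)"
proof
  assume "clinear f"
  then interpret Vector_Spaces.linear scaleC scaleC f .
  show "(\<forall>x y. f (x + y) = f x + f y) \<and> (\<forall>c x. f (c *\<^sub>C x) = c *\<^sub>C f x)"
    by (simp add: add scale)
next
  assume *: "(\<forall>x y. f (x + y) = f x + f y) \<and> (\<forall>c x. f (c *\<^sub>C x) = c *\<^sub>C f x)"
  show "clinear f"
    unfolding Vector_Spaces.linear_def module_hom_def module_hom_axioms_def module_iff_vector_space
    using * by (simp add: vector_space_scaleC)
qed

lemma clinear_add: "clinear f \<Longrightarrow> f (x + y) = f x + f y"
  and clinear_scaleC: "clinear f \<Longrightarrow> f (c *\<^sub>C x) = c *\<^sub>C f x"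
  by (auto simp: clinear_iff)

lemma clinear_diff: "clinear f \<Longrightarrow> f (x - y) = f x - f y"
  by (metis clinear_add add_diff_cancel diff_add_cancel)

lemma clinear_zero: "clinear f \<Longrightarrow> f 0 = 0"
  by (metis clinear_diff diff_self)

lemma scaleC_zero_left: "0 *\<^sub>C (x::'a::complex_vector) = 0"
  using scaleC_add_left[of 0 0 x] by simp

lemma scaleC_zero_right: "c *\<^sub>C (0::'a::complex_vector) = 0"
  using scaleC_add_right[of c 0 0] by simp

lemma scaleC_minus_one: "(-1) *\<^sub>C x = - (x::'a::complex_vector)"
  using scaleC_add_left[of "-1" 1 x] by (simp add: scaleC_zero_left scaleC_one eq_neg_iff_add_eq_0)

lemma scaleC_diff_right: "c *\<^sub>C (x - y) = c *\<^sub>C x - c *\<^sub>C (y::'a::complex_vector)"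
  by (metis scaleC_add_right add_diff_cancel diff_add_cancel)

definition bounded_clinear :: "('a::complex_normed_vector \<Rightarrow> 'b::complex_normed_vector) \<Rightarrow> bool" where
  "bounded_clinear f \<longleftrightarrow> clinear f \<and> (\<exists>K. \<forall>x. norm (f x) \<le> norm x * K)"

lemma bounded_clinear_imp_bounded_linear: "bounded_clinear f \<Longrightarrow> bounded_linear f"
  unfolding bounded_clinear_def clinear_iff
  by (auto intro!: bounded_linear_intro simp: scaleR_scaleC)

definition cbilinear ::
    "('a::complex_vector \<Rightarrow> 'b::complex_vector \<Rightarrow> 'c::complex_vector) \<Rightarrow> bool" where
  "cbilinear f \<longleftrightarrow> (\<forall>y. clinear (\<lambda>x. f x y)) \<and> (\<forall>x. clinear (\<lambda>y. f x y))"

lemma cbilinearD: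
  assumes "cbilinear f"
  shows "f (x + x') y = f x y + f x' y" "f (c *\<^sub>C x) y = c *\<^sub>C f x y"
    "f x (y + y') = f x y + f x y'" "f x (c *\<^sub>C y) = c *\<^sub>C f x y"
  using assms by (simp_all add: cbilinear_def clinear_iff)

definition bounded_cbilinear ::
    "('a::complex_normed_vector \<Rightarrow> 'b::complex_normed_vector \<Rightarrow> 'c::complex_normed_vector) \<Rightarrow> bool" where
  "bounded_cbilinear f \<longleftrightarrow> cbilinear f \<and> (\<exists>K. \<forall>x y. norm (f x y) \<le> norm x * norm y * K)"


section \<open>Completion of a seminormed space\<close>

class complex_seminormed_vector = complex_vector +
  fixes seminorm :: "'a \<Rightarrow> real"
  assumes seminorm_triangle: "seminorm (x + y) \<le> seminorm x + seminorm y"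
    and seminorm_scaleC: "seminorm (c *\<^sub>C x) = cmod c * seminorm x"

lemma seminorm_zero: "seminorm (0::'a::complex_seminormed_vector) = 0"
  using seminorm_scaleC[of 0 "0::'a"] by (simp add: scaleC_zero_left)

lemma seminorm_minus: "seminorm (- x) = seminorm (x::'a::complex_seminormed_vector)"
  using seminorm_scaleC[of "-1" x] by (simp add: scaleC_minus_one)

lemma seminorm_nonneg: "0 \<le> seminorm (x::'a::complex_seminormed_vector)"
  using seminorm_triangle[of x "-x"] by (simp add: seminorm_minus seminorm_zero)

lemma seminorm_commute: "seminorm (x - y) = seminorm (y - (x::'a::complex_seminormed_vector))"
  using seminorm_minus[of "x - y"] by simp

lemma seminorm_triangle3:
  "seminorm (x - z) \<le> seminorm (x - y) + seminorm (y - (z::'a::complex_seminormed_vector))"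
  using seminorm_triangle[of "x - y" "y - z"] by simp

lemma seminorm_diff_le: "\<bar>seminorm x - seminorm y\<bar> \<le> seminorm (x - (y::'a::complex_seminormed_vector))"
  using seminorm_triangle[of "x - y" y] seminorm_triangle[of "y - x" x] seminorm_commute[of x y]
  by simp

definition seminorm_Cauchy :: "(nat \<Rightarrow> 'a::complex_seminormed_vector) \<Rightarrow> bool" where
  "seminorm_Cauchy X \<longleftrightarrow> (\<forall>e>0. \<exists>M. \<forall>m\<ge>M. \<forall>n\<ge>M. seminorm (X m - X n) < e)"

definition completion_rel ::
    "(nat \<Rightarrow> 'a::complex_seminormed_vector) \<Rightarrow> (nat \<Rightarrow> 'a) \<Rightarrow> bool" where
  "completion_rel X Y \<longleftrightarrow>
     seminorm_Cauchy X \<and> seminorm_Cauchy Y \<and> (\<lambda>n. seminorm (X n - Y n)) \<longlonglongrightarrow> 0"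

lemma seminorm_Cauchy_const: "seminorm_Cauchy (\<lambda>n. x)"
  by (simp add: seminorm_Cauchy_def seminorm_zero)

lemma seminorm_tendsto_0_le:
  fixes f :: "nat \<Rightarrow> 'a::complex_seminormed_vector"
  assumes "\<And>n. seminorm (f n) \<le> g n" "g \<longlonglongrightarrow> 0"
  shows "(\<lambda>n. seminorm (f n)) \<longlonglongrightarrow> 0"
  by (rule tendsto_sandwich[of "\<lambda>_. 0" _ _ g])
    (use assms in \<open>simp_all add: seminorm_nonneg\<close>)

lemma completion_rel_refl: "seminorm_Cauchy X \<Longrightarrow> completion_rel X X"
  by (simp add: completion_rel_def seminorm_zero)

lemma completion_rel_sym: "completion_rel X Y \<Longrightarrow> completion_rel Y X"
  by (simp add: completion_rel_def seminorm_commute)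

lemma completion_rel_trans:
  assumes "completion_rel X Y" "completion_rel Y Z"
  shows "completion_rel X Z"
proof -
  have "(\<lambda>n. seminorm (X n - Y n) + seminorm (Y n - Z n)) \<longlonglongrightarrow> 0 + 0"
    using assms unfolding completion_rel_def by (intro tendsto_add) auto
  then have "(\<lambda>n. seminorm (X n - Z n)) \<longlonglongrightarrow> 0"
    by (intro seminorm_tendsto_0_le[OF seminorm_triangle3]) simp
  with assms show ?thesis by (simp add: completion_rel_def)
qed

text \<open>
  The seminorm need not be definite: identifying sequences whose difference is null also
  performs the quotient by the kernel of the seminorm.
\<close>

quotient_type (overloaded) 'a completion = "nat \<Rightarrow> 'a::complex_seminormed_vector" / partial: completion_rel
proof (rule part_equivpI)
  show "\<exists>x::nat \<Rightarrow> 'a. completion_rel x x"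
    using completion_rel_refl seminorm_Cauchy_const by blast
  show "symp (completion_rel :: (nat \<Rightarrow> 'a) \<Rightarrow> _)"
    by (rule sympI) (rule completion_rel_sym)
  show "transp (completion_rel :: (nat \<Rightarrow> 'a) \<Rightarrow> _)"
    by (rule transpI) (rule completion_rel_trans)
qed

lemma seminorm_Cauchy_add:
  assumes "seminorm_Cauchy X" "seminorm_Cauchy Y"
  shows "seminorm_Cauchy (\<lambda>n. X n + Y n)"
  unfolding seminorm_Cauchy_def
proof (intro allI impI)
  fix e :: real assume "e > 0"
  then obtain M N where M: "\<forall>m\<ge>M. \<forall>n\<ge>M. seminorm (X m - X n) < e / 2"
    and N: "\<forall>m\<ge>N. \<forall>n\<ge>N. seminorm (Y m - Y n) < e / 2"
    using assms unfolding seminorm_Cauchy_def by (meson half_gt_zero)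
  have "seminorm ((X m + Y m) - (X n + Y n)) < e" if "m \<ge> max M N" "n \<ge> max M N" for m n
  proof -
    have "seminorm ((X m + Y m) - (X n + Y n)) \<le> seminorm (X m - X n) + seminorm (Y m - Y n)"
      using seminorm_triangle[of "X m - X n" "Y m - Y n"] by (simp add: algebra_simps)
    moreover have "seminorm (X m - X n) < e / 2" "seminorm (Y m - Y n) < e / 2"
      using M N that by simp_all
    ultimately show ?thesis by linarith
  qed
  then show "\<exists>M. \<forall>m\<ge>M. \<forall>n\<ge>M. seminorm ((X m + Y m) - (X n + Y n)) < e" by blast
qed

lemma seminorm_Cauchy_scaleC:
  assumes "seminorm_Cauchy X"
  shows "seminorm_Cauchy (\<lambda>n. c *\<^sub>C X n)"
  unfolding seminorm_Cauchy_def
proof (intro allI impI)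
  fix e :: real assume "e > 0"
  then have "e / (cmod c + 1) > 0" by (simp add: add_nonneg_pos)
  then obtain M where M: "\<forall>m\<ge>M. \<forall>n\<ge>M. seminorm (X m - X n) < e / (cmod c + 1)"
    using assms unfolding seminorm_Cauchy_def by blast
  have "seminorm (c *\<^sub>C X m - c *\<^sub>C X n) < e" if "m \<ge> M" "n \<ge> M" for m n
  proof -
    have "seminorm (c *\<^sub>C X m - c *\<^sub>C X n) = cmod c * seminorm (X m - X n)"
      by (simp add: scaleC_diff_right[symmetric] seminorm_scaleC)
    also have "\<dots> \<le> (cmod c + 1) * seminorm (X m - X n)"
      by (simp add: mult_right_mono seminorm_nonneg)
    also have "\<dots> < e"
      using M that by (simp add: pos_less_divide_eq add_nonneg_pos mult.commute)
    finally show ?thesis .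
  qed
  then show "\<exists>M. \<forall>m\<ge>M. \<forall>n\<ge>M. seminorm (c *\<^sub>C X m - c *\<^sub>C X n) < e" by blast
qed

lemma completion_rel_add:
  assumes "completion_rel X X'" "completion_rel Y Y'"
  shows "completion_rel (\<lambda>n. X n + Y n) (\<lambda>n. X' n + Y' n)"
proof -
  have "(\<lambda>n. seminorm (X n - X' n) + seminorm (Y n - Y' n)) \<longlonglongrightarrow> 0 + 0"
    using assms unfolding completion_rel_def by (intro tendsto_add) auto
  moreover have "seminorm ((X n + Y n) - (X' n + Y' n)) \<le> seminorm (X n - X' n) + seminorm (Y n - Y' n)" for n
    using seminorm_triangle[of "X n - X' n" "Y n - Y' n"] by (simp add: algebra_simps)
  ultimately have "(\<lambda>n. seminorm ((X n + Y n) - (X' n + Y' n))) \<longlonglongrightarrow> 0"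
    by (intro seminorm_tendsto_0_le) simp_all
  with assms show ?thesis by (simp add: completion_rel_def seminorm_Cauchy_add)
qed

lemma completion_rel_scaleC:
  assumes "completion_rel X Y"
  shows "completion_rel (\<lambda>n. c *\<^sub>C X n) (\<lambda>n. c *\<^sub>C Y n)"
proof -
  have "(\<lambda>n. cmod c * seminorm (X n - Y n)) \<longlonglongrightarrow> cmod c * 0"
    using assms unfolding completion_rel_def by (intro tendsto_mult) auto
  then have "(\<lambda>n. seminorm (c *\<^sub>C X n - c *\<^sub>C Y n)) \<longlonglongrightarrow> 0"
    by (simp add: scaleC_diff_right[symmetric] seminorm_scaleC)
  with assms show ?thesis by (simp add: completion_rel_def seminorm_Cauchy_scaleC)
qed

lemma seminorm_Cauchy_convergent:
  assumes "seminorm_Cauchy X"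
  shows "convergent (\<lambda>n. seminorm (X n))"
proof (rule Cauchy_convergent, rule metric_CauchyI)
  fix e :: real assume "e > 0"
  then obtain M where "\<forall>m\<ge>M. \<forall>n\<ge>M. seminorm (X m - X n) < e"
    using assms unfolding seminorm_Cauchy_def by blast
  then show "\<exists>M. \<forall>m\<ge>M. \<forall>n\<ge>M. dist (seminorm (X m)) (seminorm (X n)) < e"
    by (metis dist_real_def le_less_trans seminorm_diff_le)
qed

lemma seminorm_Cauchy_LIMSEQ:
  "seminorm_Cauchy X \<Longrightarrow> (\<lambda>n. seminorm (X n)) \<longlonglongrightarrow> lim (\<lambda>n. seminorm (X n))"
  by (simp add: seminorm_Cauchy_convergent convergent_LIMSEQ_iff[symmetric])

lemma completion_rel_lim:
  assumes "completion_rel X Y"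
  shows "lim (\<lambda>n. seminorm (X n)) = lim (\<lambda>n. seminorm (Y n))"
proof -
  have "(\<lambda>n. seminorm (X n) - seminorm (Y n)) \<longlonglongrightarrow> 0"
    by (rule tendsto_rabs_zero_cancel, rule tendsto_sandwich[of "\<lambda>_. 0" _ _ "\<lambda>n. seminorm (X n - Y n)"])
      (use assms in \<open>simp_all add: seminorm_diff_le completion_rel_def\<close>)
  moreover have "(\<lambda>n. seminorm (X n) - seminorm (Y n)) \<longlonglongrightarrow>
      lim (\<lambda>n. seminorm (X n)) - lim (\<lambda>n. seminorm (Y n))"
    using assms unfolding completion_rel_def by (intro tendsto_diff seminorm_Cauchy_LIMSEQ) auto
  ultimately show ?thesis
    using LIMSEQ_unique by fastforce
qed

instantiation completion :: (complex_seminormed_vector) complex_vector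
begin

lift_definition zero_completion :: "'a completion" is "\<lambda>n. 0"
  by (rule completion_rel_refl[OF seminorm_Cauchy_const])

lift_definition plus_completion :: "'a completion \<Rightarrow> 'a completion \<Rightarrow> 'a completion"
  is "\<lambda>X Y n. X n + Y n"
  by (rule completion_rel_add)

lift_definition scaleC_completion :: "complex \<Rightarrow> 'a completion \<Rightarrow> 'a completion"
  is "\<lambda>c X n. c *\<^sub>C X n"
  by (rule completion_rel_scaleC)

definition uminus_completion :: "'a completion \<Rightarrow> 'a completion" where
  "- x = (-1) *\<^sub>C (x :: 'a completion)"

definition minus_completion :: "'a completion \<Rightarrow> 'a completion \<Rightarrow> 'a completion" where
  "x - y = x + - (y :: 'a completion)"

definition scaleR_completion :: "real \<Rightarrow> 'a completion \<Rightarrow> 'a completion" where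
  "r *\<^sub>R x = complex_of_real r *\<^sub>C (x :: 'a completion)"

instance
proof
  fix x y z :: "'a completion" and a b :: complex and r :: real
  show "x + y + z = x + (y + z)"
    by transfer (auto simp: add.assoc intro!: completion_rel_refl seminorm_Cauchy_add
        dest: completion_rel_def[THEN iffD1])
  show "x + y = y + x"
    by transfer (auto simp: add.commute intro!: completion_rel_refl seminorm_Cauchy_add
        dest: completion_rel_def[THEN iffD1])
  show "0 + x = x"
    by transfer simp
  show sC1: "1 *\<^sub>C x = x"
    by transfer (simp add: scaleC_one)
  show sCl: "(a + b) *\<^sub>C x = a *\<^sub>C x + b *\<^sub>C x" for a b and x :: "'a completion"
    by transfer (auto simp: scaleC_add_left intro!: completion_rel_refl seminorm_Cauchy_add
        seminorm_Cauchy_scaleC dest: completion_rel_def[THEN iffD1])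
  have z: "0 *\<^sub>C x = 0" for x :: "'a completion"
    by transfer (auto simp: scaleC_zero_left intro: completion_rel_refl seminorm_Cauchy_const)
  show "- x + x = 0"
    using sCl[of "-1" 1 x] by (simp add: uminus_completion_def sC1 z)
  show "x - y = x + - y"
    by (simp add: minus_completion_def)
  show "r *\<^sub>R x = complex_of_real r *\<^sub>C x"
    by (simp add: scaleR_completion_def)
  show "a *\<^sub>C (x + y) = a *\<^sub>C x + a *\<^sub>C y"
    by transfer (auto simp: scaleC_add_right intro!: completion_rel_refl seminorm_Cauchy_add
        seminorm_Cauchy_scaleC dest: completion_rel_def[THEN iffD1])
  show "a *\<^sub>C b *\<^sub>C x = (a * b) *\<^sub>C x"
    by transfer (auto simp: scaleC_scaleC intro!: completion_rel_refl
        seminorm_Cauchy_scaleC dest: completion_rel_def[THEN iffD1])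
qed

end

instantiation completion :: (complex_seminormed_vector) complex_normed_vector
begin

lift_definition norm_completion :: "'a completion \<Rightarrow> real" is "\<lambda>X. lim (\<lambda>n. seminorm (X n))"
  by (rule completion_rel_lim)

definition sgn_completion :: "'a completion \<Rightarrow> 'a completion" where
  "sgn x = inverse (norm x) *\<^sub>R (x :: 'a completion)"

definition dist_completion :: "'a completion \<Rightarrow> 'a completion \<Rightarrow> real" where
  "dist x y = norm (x - (y :: 'a completion))"

definition uniformity_completion :: "('a completion \<times> 'a completion) filter" where
  "uniformity = (INF e\<in>{0 <..}. principal {(x, y). dist x (y::'a completion) < e})"

definition open_completion :: "'a completion set \<Rightarrow> bool" where
  "open U \<longleftrightarrow> (\<forall>x\<in>U. \<forall>\<^sub>F (x', y) in uniformity. x' = x \<longrightarrow> y \<in> (U :: 'a completion set))"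

instance
proof
  fix x y :: "'a completion" and a :: complex and r :: real
  show "sgn x = inverse (norm x) *\<^sub>R x"
    by (simp add: sgn_completion_def)
  show "dist x y = norm (x - y)"
    by (simp add: dist_completion_def)
  show "uniformity = (INF e\<in>{0 <..}. principal {(x, y). dist x (y::'a completion) < e})"
    by (simp add: uniformity_completion_def)
  show "open U \<longleftrightarrow> (\<forall>x\<in>U. \<forall>\<^sub>F (x', y) in uniformity. x' = x \<longrightarrow> y \<in> U)" for U :: "'a completion set"
    by (simp add: open_completion_def)
  show "norm x = 0 \<longleftrightarrow> x = 0"
  proof transfer
    fix X :: "nat \<Rightarrow> 'a" assume "completion_rel X X"
    then have X: "seminorm_Cauchy X" by (simp add: completion_rel_def)
    then have "(\<lambda>n. seminorm (X n)) \<longlonglongrightarrow> lim (\<lambda>n. seminorm (X n))"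
      by (rule seminorm_Cauchy_LIMSEQ)
    then show "lim (\<lambda>n. seminorm (X n)) = 0 \<longleftrightarrow> completion_rel X (\<lambda>n. 0)"
      using X limI[of "\<lambda>n. seminorm (X n)" 0]
      by (simp add: completion_rel_def seminorm_Cauchy_const) metis
  qed
  show "norm (x + y) \<le> norm x + norm y"
  proof transfer
    fix X Y :: "nat \<Rightarrow> 'a" assume "completion_rel X X" "completion_rel Y Y"
    then have XY: "seminorm_Cauchy X" "seminorm_Cauchy Y" by (simp_all add: completion_rel_def)
    show "lim (\<lambda>n. seminorm (X n + Y n)) \<le> lim (\<lambda>n. seminorm (X n)) + lim (\<lambda>n. seminorm (Y n))"
    proof (rule LIMSEQ_le)
      show "(\<lambda>n. seminorm (X n + Y n)) \<longlonglongrightarrow> lim (\<lambda>n. seminorm (X n + Y n))"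
        by (rule seminorm_Cauchy_LIMSEQ[OF seminorm_Cauchy_add[OF XY]])
      show "(\<lambda>n. seminorm (X n) + seminorm (Y n)) \<longlonglongrightarrow>
          lim (\<lambda>n. seminorm (X n)) + lim (\<lambda>n. seminorm (Y n))"
        using XY by (intro tendsto_add seminorm_Cauchy_LIMSEQ)
    qed (simp add: seminorm_triangle)
  qed
  show nC: "norm (a *\<^sub>C x) = cmod a * norm x" for a
  proof transfer
    fix a and X :: "nat \<Rightarrow> 'a" assume "completion_rel X X"
    then have "seminorm_Cauchy X" by (simp add: completion_rel_def)
    then have "(\<lambda>n. seminorm (X n)) \<longlonglongrightarrow> lim (\<lambda>n. seminorm (X n))"
      by (rule seminorm_Cauchy_LIMSEQ)
    then show "lim (\<lambda>n. seminorm (a *\<^sub>C X n)) = cmod a * lim (\<lambda>n. seminorm (X n))"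
      by (intro limI) (auto simp: seminorm_scaleC intro: tendsto_mult_left)
  qed
  show "norm (r *\<^sub>R x) = \<bar>r\<bar> * norm x"
    by (simp add: scaleR_scaleC nC)
qed

end

lift_definition to_completion :: "'a::complex_seminormed_vector \<Rightarrow> 'a completion" is "\<lambda>x n. x"
  by (rule completion_rel_refl[OF seminorm_Cauchy_const])

lemma to_completion_add: "to_completion (x + y) = to_completion x + to_completion y"
  by transfer (rule completion_rel_refl[OF seminorm_Cauchy_const])

lemma to_completion_scaleC: "to_completion (c *\<^sub>C x) = c *\<^sub>C to_completion x"
  by transfer (rule completion_rel_refl[OF seminorm_Cauchy_const])

lemma clinear_to_completion: "clinear to_completion"
  by (simp add: clinear_iff to_completion_add to_completion_scaleC)

lemma norm_to_completion: "norm (to_completion x) = seminorm x"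
  by transfer (simp add: limI)

lemma completion_obtain:
  obtains X where "seminorm_Cauchy X" "x = abs_completion X"
proof
  show "x = abs_completion (rep_completion x)"
    by (simp add: Quotient3_abs_rep[OF Quotient3_completion])
  show "seminorm_Cauchy (rep_completion x)"
    using Quotient3_rep_reflp[OF Quotient3_completion, of x] by (simp add: completion_rel_def)
qed

lemma norm_abs_completion_minus:
  assumes "seminorm_Cauchy X"
  shows "norm (abs_completion X - to_completion y) = lim (\<lambda>n. seminorm (X n - y))"
proof -
  have "abs_completion X - to_completion y = abs_completion X + to_completion (- y)"
    using clinear_diff[OF clinear_to_completion, of 0 y]
    by (simp add: clinear_zero[OF clinear_to_completion])
  also have "\<dots> = abs_completion (\<lambda>n. X n - y)"
    using assms
    by (simp add: to_completion.abs_eq plus_completion.abs_eq completion_rel_refl seminorm_Cauchy_const)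
  finally have eq: "abs_completion X - to_completion y = abs_completion (\<lambda>n. X n - y)" .
  have "seminorm_Cauchy (\<lambda>n. X n - y)"
    using seminorm_Cauchy_add[OF assms seminorm_Cauchy_const[of "-y"]] by simp
  then show ?thesis
    unfolding eq by (simp add: norm_completion.abs_eq completion_rel_refl)
qed

lemma to_completion_tendsto:
  assumes X: "seminorm_Cauchy X"
  shows "(\<lambda>n. to_completion (X n)) \<longlonglongrightarrow> abs_completion X"
proof (rule metric_LIMSEQ_I)
  fix e :: real assume "e > 0"
  then obtain M where M: "\<forall>m\<ge>M. \<forall>n\<ge>M. seminorm (X m - X n) < e / 2"
    using X unfolding seminorm_Cauchy_def by (meson half_gt_zero)
  have "dist (to_completion (X n)) (abs_completion X) < e" if n: "n \<ge> M" for n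
  proof -
    have "seminorm_Cauchy (\<lambda>m. X m - X n)"
      using seminorm_Cauchy_add[OF X seminorm_Cauchy_const[of "- X n"]] by simp
    then have "(\<lambda>m. seminorm (X m - X n)) \<longlonglongrightarrow> lim (\<lambda>m. seminorm (X m - X n))"
      by (rule seminorm_Cauchy_LIMSEQ)
    then have "lim (\<lambda>m. seminorm (X m - X n)) \<le> e / 2"
      by (rule LIMSEQ_le_const2) (use M n in \<open>auto intro: less_imp_le\<close>)
    then show ?thesis
      using \<open>e > 0\<close> by (simp add: dist_commute[of "to_completion (X n)"] dist_norm[of "abs_completion X"] norm_abs_completion_minus[OF X])
  qed
  then show "\<exists>M. \<forall>n\<ge>M. dist (to_completion (X n)) (abs_completion X) < e" by blast
qed

lemma to_completion_dense: "e > 0 \<Longrightarrow> \<exists>y. dist (to_completion y) x < e"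
proof -
  assume "e > 0"
  obtain X where X: "seminorm_Cauchy X" "x = abs_completion X"
    by (rule completion_obtain)
  then show ?thesis
    using metric_LIMSEQ_D[OF to_completion_tendsto[OF X(1)] \<open>e > 0\<close>] by blast
qed

instance completion :: (complex_seminormed_vector) complex_banach
proof
  fix X :: "nat \<Rightarrow> 'a completion" assume X: "Cauchy X"
  obtain y where y: "dist (to_completion (y n)) (X n) < inverse (real (Suc n))" for n
  proof -
    have "\<exists>y. \<forall>n. dist (to_completion (y n)) (X n) < inverse (real (Suc n))"
      by (rule choice, rule allI, rule to_completion_dense) simp
    then show ?thesis using that by blast
  qed
  have lim0: "(\<lambda>n. dist (to_completion (y n)) (X n)) \<longlonglongrightarrow> 0"
    by (rule tendsto_sandwich[OF _ _ tendsto_const LIMSEQ_inverse_real_of_nat])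
      (use y less_imp_le in \<open>auto intro!: always_eventually\<close>)
  have dist_y: "dist (to_completion u) (to_completion v) = seminorm (u - v)" for u v :: 'a
    by (simp add: dist_norm clinear_diff[OF clinear_to_completion, symmetric] norm_to_completion)
  have "seminorm_Cauchy y"
    unfolding seminorm_Cauchy_def
  proof (intro allI impI)
    fix e :: real assume "e > 0"
    then have e3: "e / 3 > 0" by simp
    obtain M where M: "\<forall>m\<ge>M. \<forall>n\<ge>M. dist (X m) (X n) < e / 3"
      using metric_CauchyD[OF X e3] by blast
    obtain N where N: "\<forall>n\<ge>N. dist (to_completion (y n)) (X n) < e / 3"
      using metric_LIMSEQ_D[OF lim0 e3] by (auto simp: dist_real_def)
    have "seminorm (y m - y n) < e" if "m \<ge> max M N" "n \<ge> max M N" for m n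
    proof -
      have "dist (to_completion (y m)) (to_completion (y n)) \<le>
          dist (to_completion (y m)) (X m) + (dist (X m) (X n) + dist (to_completion (y n)) (X n))"
        by (metis add_left_mono dist_commute dist_triangle order_trans)
      moreover have "dist (to_completion (y m)) (X m) < e / 3" "dist (to_completion (y n)) (X n) < e / 3"
        "dist (X m) (X n) < e / 3"
        using M N that by auto
      ultimately show ?thesis by (simp add: dist_y)
    qed
    then show "\<exists>M. \<forall>m\<ge>M. \<forall>n\<ge>M. seminorm (y m - y n) < e" by blast
  qed
  then have "(\<lambda>n. to_completion (y n)) \<longlonglongrightarrow> abs_completion y"
    by (rule to_completion_tendsto)
  moreover have "(\<lambda>n. X n - to_completion (y n)) \<longlonglongrightarrow> 0"
  proof (rule tendsto_norm_zero_cancel)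
    have "norm (X n - to_completion (y n)) = dist (to_completion (y n)) (X n)" for n
      by (simp only: dist_norm norm_minus_commute)
    then show "(\<lambda>n. norm (X n - to_completion (y n))) \<longlonglongrightarrow> 0"
      using lim0 by presburger
  qed
  ultimately have "(\<lambda>n. X n - to_completion (y n) + to_completion (y n)) \<longlonglongrightarrow> 0 + abs_completion y"
    by (intro tendsto_add)
  then have "X \<longlonglongrightarrow> abs_completion y" by simp
  then show "convergent X" by (rule convergentI)
qed

lemma completion_extend:
  fixes g :: "'a::complex_seminormed_vector \<Rightarrow> 'b::complex_banach"
  assumes g: "clinear g" and K: "\<And>x. norm (g x) \<le> seminorm x * K"
  shows "\<exists>L. bounded_clinear L \<and> (\<forall>x. L (to_completion x) = g x)"
proof -
  have K0: "norm (g x) \<le> seminorm x * max K 1" for x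
    using K[of x] by (smt (verit) max.cobounded1 mult_left_mono seminorm_nonneg)
  have "\<exists>l. \<forall>X. seminorm_Cauchy X \<and> abs_completion X = \<xi> \<longrightarrow> (\<lambda>n. g (X n)) \<longlonglongrightarrow> l" for \<xi> :: "'a completion"
  proof -
    obtain X where X: "seminorm_Cauchy X" "\<xi> = abs_completion X"
      by (rule completion_obtain)
    have "Cauchy (\<lambda>n. g (X n))"
    proof (rule metric_CauchyI)
      fix e :: real assume "e > 0"
      then have "e / max K 1 > 0" by simp
      then obtain M where M: "\<forall>m\<ge>M. \<forall>n\<ge>M. seminorm (X m - X n) < e / max K 1"
        using X(1) unfolding seminorm_Cauchy_def by blast
      have "dist (g (X m)) (g (X n)) < e" if "m \<ge> M" "n \<ge> M" for m n
      proof -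
        have "dist (g (X m)) (g (X n)) \<le> seminorm (X m - X n) * max K 1"
          using K0[of "X m - X n"] by (simp add: dist_norm clinear_diff[OF g])
        also have "\<dots> < e"
          using M that pos_less_divide_eq[of "max K 1" "seminorm (X m - X n)" e] by simp
        finally show ?thesis .
      qed
      then show "\<exists>M. \<forall>m\<ge>M. \<forall>n\<ge>M. dist (g (X m)) (g (X n)) < e" by blast
    qed
    then obtain l where l: "(\<lambda>n. g (X n)) \<longlonglongrightarrow> l"
      using Cauchy_convergent convergent_def by blast
    have "(\<lambda>n. g (Y n)) \<longlonglongrightarrow> l" if Y: "seminorm_Cauchy Y" "abs_completion Y = \<xi>" for Y
    proof -
      have "completion_rel Y X"
        using X Y completion_rel_refl[OF X(1)] completion_rel_refl[OF Y(1)]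
          Quotient3_rel[OF Quotient3_completion, of Y X] by blast
      then have "(\<lambda>n. seminorm (Y n - X n) * max K 1) \<longlonglongrightarrow> 0 * max K 1"
        unfolding completion_rel_def by (intro tendsto_mult) auto
      then have lim: "(\<lambda>n. seminorm (Y n - X n) * max K 1) \<longlonglongrightarrow> 0"
        unfolding mult_zero_left .
      have le: "norm (g (Y n) - g (X n)) \<le> seminorm (Y n - X n) * max K 1" for n
        using K0[of "Y n - X n"] unfolding clinear_diff[OF g] .
      have "(\<lambda>n. g (Y n) - g (X n)) \<longlonglongrightarrow> 0"
        by (rule Lim_null_comparison[OF always_eventually lim]) (rule allI, rule le)
      from tendsto_add[OF this l] show ?thesis unfolding diff_add_cancel add_0_left .
    qed
    then show ?thesis by blast
  qed
  then obtain L where L: "\<And>X. seminorm_Cauchy X \<Longrightarrow> (\<lambda>n. g (X n)) \<longlonglongrightarrow> L (abs_completion X)"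
    by metis
  have "L (\<xi> + \<eta>) = L \<xi> + L \<eta>" for \<xi> \<eta>
  proof -
    obtain X where X: "seminorm_Cauchy X" "\<xi> = abs_completion X"
      by (rule completion_obtain)
    obtain Y where Y: "seminorm_Cauchy Y" "\<eta> = abs_completion Y"
      by (rule completion_obtain)
    have "\<xi> + \<eta> = abs_completion (\<lambda>n. X n + Y n)"
      using X Y by (simp add: plus_completion.abs_eq completion_rel_refl)
    then have "(\<lambda>n. g (X n + Y n)) \<longlonglongrightarrow> L (\<xi> + \<eta>)"
      using L[OF seminorm_Cauchy_add[OF X(1) Y(1)]] by simp
    moreover have "(\<lambda>n. g (X n + Y n)) \<longlonglongrightarrow> L \<xi> + L \<eta>"
      unfolding clinear_add[OF g] X(2) Y(2) by (rule tendsto_add[OF L[OF X(1)] L[OF Y(1)]])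
    ultimately show ?thesis by (rule LIMSEQ_unique)
  qed
  moreover have "L (c *\<^sub>C \<xi>) = c *\<^sub>C L \<xi>" for c \<xi>
  proof -
    obtain X where X: "seminorm_Cauchy X" "\<xi> = abs_completion X"
      by (rule completion_obtain)
    have "bounded_linear (\<lambda>x::'b. c *\<^sub>C x)"
      by (rule bounded_linear_intro[where K = "cmod c"])
        (simp_all add: scaleC_add_right scaleR_scaleC scaleC_scaleC mult.commute norm_scaleC)
    then have "(\<lambda>n. c *\<^sub>C g (X n)) \<longlonglongrightarrow> c *\<^sub>C L \<xi>"
      unfolding X(2) by (rule bounded_linear.tendsto[OF _ L[OF X(1)]])
    moreover have "c *\<^sub>C \<xi> = abs_completion (\<lambda>n. c *\<^sub>C X n)"
      using X by (simp add: scaleC_completion.abs_eq completion_rel_refl)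
    then have "(\<lambda>n. g (c *\<^sub>C X n)) \<longlonglongrightarrow> L (c *\<^sub>C \<xi>)"
      using L[OF seminorm_Cauchy_scaleC[OF X(1)]] by simp
    ultimately show ?thesis
      unfolding clinear_scaleC[OF g] by (metis LIMSEQ_unique)
  qed
  moreover have "norm (L \<xi>) \<le> norm \<xi> * K" for \<xi>
  proof -
    obtain X where X: "seminorm_Cauchy X" "\<xi> = abs_completion X"
      by (rule completion_obtain)
    show ?thesis
    proof (rule LIMSEQ_le)
      show "(\<lambda>n. norm (g (X n))) \<longlonglongrightarrow> norm (L \<xi>)"
        unfolding X(2) by (rule tendsto_norm[OF L[OF X(1)]])
      show "(\<lambda>n. norm (to_completion (X n)) * K) \<longlonglongrightarrow> norm \<xi> * K"
        unfolding X(2) by (intro tendsto_intros to_completion_tendsto X(1))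
    qed (simp add: norm_to_completion K)
  qed
  moreover have "L (to_completion x) = g x" for x
    using L[OF seminorm_Cauchy_const[of x]] by (simp add: to_completion.abs_eq LIMSEQ_const_iff)
  ultimately show ?thesis
    unfolding bounded_clinear_def clinear_iff by blast
qed

lemma completion_maps_eqI:
  fixes L L' :: "'a::complex_seminormed_vector completion \<Rightarrow> 'b::complex_banach"
  assumes "bounded_clinear L" "bounded_clinear L'"
    and "\<And>x::'a. L (to_completion x) = L' (to_completion x)"
  shows "L = L'"
proof
  fix \<xi> :: "'a completion"
  obtain X where X: "seminorm_Cauchy X" "\<xi> = abs_completion X"
    by (rule completion_obtain)
  then have "(\<lambda>n. to_completion (X n)) \<longlonglongrightarrow> \<xi>"
    using to_completion_tendsto by blast
  then have "(\<lambda>n. L (to_completion (X n))) \<longlonglongrightarrow> L \<xi>" "(\<lambda>n. L' (to_completion (X n))) \<longlonglongrightarrow> L' \<xi>"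
    using assms(1,2)[THEN bounded_clinear_imp_bounded_linear] by (auto intro: bounded_linear.tendsto)
  then show "L \<xi> = L' \<xi>"
    using assms(3) LIMSEQ_unique by simp
qed


section \<open>The projective tensor product\<close>

text \<open>
  The algebraic tensor product is realized inside the linear functionals on the space of all
  (not necessarily bounded) bilinear forms \<open>f\<close>, with \<open>x \<otimes> y\<close> being evaluation \<open>f \<mapsto> f x y\<close>.
  Such functionals are represented as total functions vanishing outside the bilinear forms.
  The linear span of the elementary tensors consists of their finite sums, because
  \<open>c (x \<otimes> y) = (c x) \<otimes> y\<close>.
\<close>

definition eval_tensor ::
    "('a::complex_banach \<times> 'b::complex_banach) list \<Rightarrow> ('a \<Rightarrow> 'b \<Rightarrow> complex) \<Rightarrow> complex" where
  "eval_tensor xs f = (if cbilinear f then \<Sum>(x, y)\<leftarrow>xs. f x y else 0)"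

typedef (overloaded) ('a, 'b) alg_tensor =
  "range (eval_tensor :: ('a::complex_banach \<times> 'b::complex_banach) list \<Rightarrow> _)"
  by blast

setup_lifting type_definition_alg_tensor

lemma eval_tensor_append: "eval_tensor (xs @ ys) f = eval_tensor xs f + eval_tensor ys f"
  by (simp add: eval_tensor_def)

lemma eval_tensor_scale:
  "eval_tensor (map (\<lambda>(x, y). (c *\<^sub>C x, y)) xs) f = c * eval_tensor xs f"
proof (cases "cbilinear f")
  case True
  then have "f (c *\<^sub>C x) y = c * f x y" for x y
    by (simp add: cbilinear_def clinear_iff scaleC_complex_def)
  with True show ?thesis
    by (induction xs) (auto simp: eval_tensor_def algebra_simps)
qed (simp add: eval_tensor_def)

instantiation alg_tensor :: (complex_banach, complex_banach) complex_vector
begin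

lift_definition zero_alg_tensor :: "('a, 'b) alg_tensor" is "\<lambda>f. 0"
  by (rule range_eqI[of _ _ "[]"]) (simp add: eval_tensor_def fun_eq_iff)

lift_definition plus_alg_tensor :: "('a, 'b) alg_tensor \<Rightarrow> ('a, 'b) alg_tensor \<Rightarrow> ('a, 'b) alg_tensor"
  is "\<lambda>u v f. u f + v f"
  by (auto simp flip: eval_tensor_append)

lift_definition scaleC_alg_tensor :: "complex \<Rightarrow> ('a, 'b) alg_tensor \<Rightarrow> ('a, 'b) alg_tensor"
  is "\<lambda>c u f. c * u f"
  by (auto simp flip: eval_tensor_scale)

definition uminus_alg_tensor :: "('a, 'b) alg_tensor \<Rightarrow> ('a, 'b) alg_tensor" where
  "- u = (-1) *\<^sub>C (u :: ('a, 'b) alg_tensor)"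

definition minus_alg_tensor :: "('a, 'b) alg_tensor \<Rightarrow> ('a, 'b) alg_tensor \<Rightarrow> ('a, 'b) alg_tensor" where
  "u - v = u + - (v :: ('a, 'b) alg_tensor)"

definition scaleR_alg_tensor :: "real \<Rightarrow> ('a, 'b) alg_tensor \<Rightarrow> ('a, 'b) alg_tensor" where
  "r *\<^sub>R u = complex_of_real r *\<^sub>C (u :: ('a, 'b) alg_tensor)"

instance
  by intro_classes
    (simp_all add: minus_alg_tensor_def uminus_alg_tensor_def scaleR_alg_tensor_def
      Rep_alg_tensor_inject[symmetric] zero_alg_tensor.rep_eq plus_alg_tensor.rep_eq
      scaleC_alg_tensor.rep_eq fun_eq_iff algebra_simps)

end

lift_definition elem_tensor :: "'a::complex_banach \<Rightarrow> 'b::complex_banach \<Rightarrow> ('a, 'b) alg_tensor"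
  is "\<lambda>x y f. if cbilinear f then f x y else 0"
  subgoal for x y
    by (rule range_eqI[of _ _ "[(x, y)]"]) (simp add: eval_tensor_def fun_eq_iff)
  done

lemma Rep_sum_elem_tensor:
  "Rep_alg_tensor (\<Sum>(x, y)\<leftarrow>xs. elem_tensor x y) = eval_tensor xs"
proof (induction xs)
  case Nil
  then show ?case by (simp add: zero_alg_tensor.rep_eq eval_tensor_def fun_eq_iff)
next
  case (Cons p xs)
  then show ?case
    by (cases p) (simp add: plus_alg_tensor.rep_eq elem_tensor.rep_eq eval_tensor_def fun_eq_iff)
qed

lemma alg_tensor_obtain:
  obtains xs where "u = (\<Sum>(x, y)\<leftarrow>xs. elem_tensor x y)"
  by (metis Rep_alg_tensor Rep_alg_tensor_inject Rep_sum_elem_tensor imageE)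

lemma cbilinear_elem_tensor: "cbilinear elem_tensor"
  unfolding cbilinear_def[of elem_tensor] clinear_iff
proof (intro conjI allI)
  fix x x' :: 'a and y y' :: 'b and c :: complex
  note D = Rep_alg_tensor_inject[symmetric] plus_alg_tensor.rep_eq scaleC_alg_tensor.rep_eq
    elem_tensor.rep_eq fun_eq_iff
  have *: "(f :: 'a \<Rightarrow> 'b \<Rightarrow> complex) (x + x') y = f x y + f x' y" "f (c *\<^sub>C x) y = c * f x y"
    "f x (y + y') = f x y + f x y'" "f x (c *\<^sub>C y) = c * f x y" if "cbilinear f" for f
    using that by (simp_all add: cbilinear_def clinear_iff scaleC_complex_def)
  show "elem_tensor (x + x') y = elem_tensor x y + elem_tensor x' y" by (simp add: D *)
  show "elem_tensor (c *\<^sub>C x) y = c *\<^sub>C elem_tensor x y" by (simp add: D *)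
  show "elem_tensor x (y + y') = elem_tensor x y + elem_tensor x y'" by (simp add: D *)
  show "elem_tensor x (c *\<^sub>C y) = c *\<^sub>C elem_tensor x y" by (simp add: D *)
qed

definition projective_norm :: "('a::complex_banach, 'b::complex_banach) alg_tensor \<Rightarrow> real" where
  "projective_norm u =
     Inf {(\<Sum>(x, y)\<leftarrow>xs. norm x * norm y) | xs. u = (\<Sum>(x, y)\<leftarrow>xs. elem_tensor x y)}"

lemma sum_list_norms_nonneg: "0 \<le> (\<Sum>(x, y)\<leftarrow>xs. norm x * norm y)"
  by (rule sum_list_nonneg) auto

lemma projective_norm_le:
  "projective_norm (\<Sum>(x, y)\<leftarrow>xs. elem_tensor x y) \<le> (\<Sum>(x, y)\<leftarrow>xs. norm x * norm y)"
  unfolding projective_norm_def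
proof (rule cInf_lower)
  show "bdd_below {(\<Sum>(x, y)\<leftarrow>ys. norm x * norm y) | ys.
      (\<Sum>(x, y)\<leftarrow>xs. elem_tensor x y) = (\<Sum>(x, y)\<leftarrow>ys. elem_tensor x y)}"
    by (rule bdd_belowI[of _ 0]) (use sum_list_norms_nonneg in blast)
qed blast

lemma projective_norm_nonneg: "0 \<le> projective_norm u"
  unfolding projective_norm_def
proof (rule cInf_greatest)
  obtain xs where "u = (\<Sum>(x, y)\<leftarrow>xs. elem_tensor x y)"
    by (rule alg_tensor_obtain)
  then show "{(\<Sum>(x, y)\<leftarrow>xs. norm x * norm y) | xs. u = (\<Sum>(x, y)\<leftarrow>xs. elem_tensor x y)} \<noteq> {}"
    by blast
qed (use sum_list_norms_nonneg in blast)

lemma projective_norm_approx: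
  assumes "e > 0"
  obtains xs where "u = (\<Sum>(x, y)\<leftarrow>xs. elem_tensor x y)"
    "(\<Sum>(x, y)\<leftarrow>xs. norm x * norm y) < projective_norm u + e"
proof -
  let ?S = "{(\<Sum>(x, y)\<leftarrow>xs. norm x * norm y) | xs. u = (\<Sum>(x, y)\<leftarrow>xs. elem_tensor x y)}"
  obtain ys where "u = (\<Sum>(x, y)\<leftarrow>ys. elem_tensor x y)"
    by (rule alg_tensor_obtain)
  then have "?S \<noteq> {}" by blast
  moreover have "Inf ?S < projective_norm u + e"
    using assms by (simp add: projective_norm_def)
  ultimately have "\<exists>s\<in>?S. s < projective_norm u + e"
    by (rule cInf_lessD)
  then show ?thesis using that by blast
qed

lemma projective_norm_triangle: "projective_norm (u + v) \<le> projective_norm u + projective_norm v"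
proof (rule field_le_epsilon)
  fix e :: real assume "e > 0"
  then have e2: "e / 2 > 0" by simp
  obtain xs where xs: "u = (\<Sum>(x, y)\<leftarrow>xs. elem_tensor x y)"
    "(\<Sum>(x, y)\<leftarrow>xs. norm x * norm y) < projective_norm u + e / 2"
    using projective_norm_approx[OF e2] by blast
  obtain ys where ys: "v = (\<Sum>(x, y)\<leftarrow>ys. elem_tensor x y)"
    "(\<Sum>(x, y)\<leftarrow>ys. norm x * norm y) < projective_norm v + e / 2"
    using projective_norm_approx[OF e2] by blast
  show "projective_norm (u + v) \<le> projective_norm u + projective_norm v + e"
    using projective_norm_le[of "xs @ ys"] xs ys by simp
qed

lemma projective_norm_scaleC_le: "projective_norm (c *\<^sub>C u) \<le> cmod c * projective_norm u"
proof (rule field_le_epsilon)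
  fix e :: real assume e: "e > 0"
  have c1: "0 < cmod c + 1" by (simp add: add_nonneg_pos)
  with e have "e / (cmod c + 1) > 0" by simp
  then obtain xs where xs: "u = (\<Sum>(x, y)\<leftarrow>xs. elem_tensor x y)"
    "(\<Sum>(x, y)\<leftarrow>xs. norm x * norm y) < projective_norm u + e / (cmod c + 1)"
    using projective_norm_approx by blast
  let ?ys = "map (\<lambda>(x, y). (c *\<^sub>C x, y)) xs"
  have "c *\<^sub>C u = (\<Sum>(x, y)\<leftarrow>?ys. elem_tensor x y)"
    unfolding Rep_alg_tensor_inject[symmetric] Rep_sum_elem_tensor scaleC_alg_tensor.rep_eq xs(1)
    by (simp add: eval_tensor_scale fun_eq_iff)
  then have "projective_norm (c *\<^sub>C u) \<le> (\<Sum>(x, y)\<leftarrow>?ys. norm x * norm y)"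
    using projective_norm_le[of ?ys] by simp
  also have "\<dots> = cmod c * (\<Sum>(x, y)\<leftarrow>xs. norm x * norm y)"
    by (induction xs) (auto simp: norm_scaleC algebra_simps)
  also have "\<dots> \<le> cmod c * (projective_norm u + e / (cmod c + 1))"
    using xs(2) by (intro mult_left_mono) auto
  also have "\<dots> \<le> cmod c * projective_norm u + e"
    using e c1 by (simp add: field_simps)
  finally show "projective_norm (c *\<^sub>C u) \<le> cmod c * projective_norm u + e" .
qed

lemma projective_norm_scaleC: "projective_norm (c *\<^sub>C u) = cmod c * projective_norm u"
proof (cases "c = 0")
  case True
  then show ?thesis
    using projective_norm_scaleC_le[of 0 u] projective_norm_nonneg[of "0 *\<^sub>C u"] by simp
next
  case False
  have "projective_norm u \<le> cmod (inverse c) * projective_norm (c *\<^sub>C u)"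
    using projective_norm_scaleC_le[of "inverse c" "c *\<^sub>C u"] False by (simp add: scaleC_scaleC scaleC_one)
  then have "cmod c * projective_norm u \<le> projective_norm (c *\<^sub>C u)"
    using False by (simp add: norm_inverse pos_le_divide_eq[symmetric] divide_inverse mult.commute)
  then show ?thesis using projective_norm_scaleC_le[of c u] by simp
qed

instantiation alg_tensor :: (complex_banach, complex_banach) complex_seminormed_vector
begin

definition seminorm_alg_tensor :: "('a, 'b) alg_tensor \<Rightarrow> real" where
  "seminorm_alg_tensor = projective_norm"

instance
  by intro_classes
    (simp_all add: seminorm_alg_tensor_def projective_norm_triangle projective_norm_scaleC)

end

type_synonym ('a, 'b) ptensor = "('a, 'b) alg_tensor completion"

definition ptensor :: "'a::complex_banach \<Rightarrow> 'b::complex_banach \<Rightarrow> ('a, 'b) ptensor"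
    (infixl "\<otimes>\<^sub>p" 70) where
  "x \<otimes>\<^sub>p y = to_completion (elem_tensor x y)"

text \<open>The bounded linear map on the projective tensor product determined by a bounded bilinear map.\<close>

definition ptensor_lift ::
    "('a::complex_banach \<Rightarrow> 'b::complex_banach \<Rightarrow> 'c::complex_banach) \<Rightarrow> ('a, 'b) ptensor \<Rightarrow> 'c" where
  "ptensor_lift f = (THE L. bounded_clinear L \<and> (\<forall>x y. L (x \<otimes>\<^sub>p y) = f x y))"

lemma norm_ptensor_le: "norm (x \<otimes>\<^sub>p y) \<le> norm x * norm y"
  using projective_norm_le[of "[(x, y)]"]
  by (simp add: ptensor_def norm_to_completion seminorm_alg_tensor_def)

lemma cbilinear_ptensor: "cbilinear (\<otimes>\<^sub>p)"
  unfolding cbilinear_def clinear_iff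
  by (simp add: cbilinearD[OF cbilinear_elem_tensor] ptensor_def to_completion_add to_completion_scaleC)

lemmas ptensor_simps = cbilinearD[OF cbilinear_ptensor]

lemma clinear_functional_separates:
  fixes z :: "'a::complex_vector"
  assumes "z \<noteq> 0"
  shows "\<exists>g :: 'a \<Rightarrow> complex. clinear g \<and> g z \<noteq> 0"
proof -
  interpret vector_space_pair "scaleC :: complex \<Rightarrow> 'a \<Rightarrow> 'a" "scaleC :: complex \<Rightarrow> complex \<Rightarrow> complex"
    by (rule vector_space_pair.intro; rule vector_space_scaleC)
  have "vs1.independent {z}" using assms unfolding vs1.dependent_single .
  from linear_independent_extend[OF this, of "\<lambda>_. 1"]
  obtain g where "clinear g \<and> (\<forall>x\<in>{z}. g x = (1::complex))" by (rule exE)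
  then show ?thesis by (intro exI[of _ g]) simp
qed

lemma alg_tensor_sum_eq:
  fixes f :: "'a::complex_banach \<Rightarrow> 'b::complex_banach \<Rightarrow> 'c::complex_vector"
  assumes f: "cbilinear f"
    and eq: "(\<Sum>(x, y)\<leftarrow>xs. elem_tensor x y) = (\<Sum>(x, y)\<leftarrow>ys. elem_tensor x y)"
  shows "(\<Sum>(x, y)\<leftarrow>xs. f x y) = (\<Sum>(x, y)\<leftarrow>ys. f x y)"
proof (rule ccontr)
  assume "(\<Sum>(x, y)\<leftarrow>xs. f x y) \<noteq> (\<Sum>(x, y)\<leftarrow>ys. f x y)"
  then obtain g :: "'c \<Rightarrow> complex" where g: "clinear g"
    and ne: "g ((\<Sum>(x, y)\<leftarrow>xs. f x y) - (\<Sum>(x, y)\<leftarrow>ys. f x y)) \<noteq> 0"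
    using clinear_functional_separates by (metis eq_iff_diff_eq_0)
  have "cbilinear (\<lambda>x y. g (f x y))"
    using f g by (simp add: cbilinear_def clinear_iff)
  then have ev: "eval_tensor zs (\<lambda>x y. g (f x y)) = g (\<Sum>(x, y)\<leftarrow>zs. f x y)" for zs
    by (induction zs) (auto simp: eval_tensor_def clinear_zero[OF g] clinear_add[OF g])
  have "eval_tensor xs = eval_tensor ys"
    using eq by (simp flip: Rep_sum_elem_tensor)
  then show False
    using ne ev[of xs] ev[of ys] by (simp add: clinear_diff[OF g])
qed

lemma ptensor_universal:
  fixes f :: "'a::complex_banach \<Rightarrow> 'b::complex_banach \<Rightarrow> 'c::complex_banach"
  assumes "bounded_cbilinear f"
  shows "\<exists>!L. bounded_clinear L \<and> (\<forall>x y. L (x \<otimes>\<^sub>p y) = f x y)"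
proof -
  from assms obtain K0 where f: "cbilinear f" and K0: "\<And>x y. norm (f x y) \<le> norm x * norm y * K0"
    by (auto simp: bounded_cbilinear_def)
  define K where "K = max K0 1"
  have K: "norm (f x y) \<le> norm x * norm y * K" for x y
    using K0[of x y] by (smt (verit) K_def max.cobounded1 mult_left_mono mult_nonneg_nonneg norm_ge_zero)
  have K_pos: "K > 0" by (simp add: K_def)
  have "\<exists>z. \<forall>xs. u = (\<Sum>(x, y)\<leftarrow>xs. elem_tensor x y) \<longrightarrow> z = (\<Sum>(x, y)\<leftarrow>xs. f x y)" for u
  proof -
    obtain ys where ys: "u = (\<Sum>(x, y)\<leftarrow>ys. elem_tensor x y)"
      by (rule alg_tensor_obtain)
    show ?thesis
      using alg_tensor_sum_eq[OF f, of ys] by (intro exI[of _ "\<Sum>(x, y)\<leftarrow>ys. f x y"]) (simp add: ys)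
  qed
  then obtain g where g: "\<And>xs. g (\<Sum>(x, y)\<leftarrow>xs. elem_tensor x y) = (\<Sum>(x, y)\<leftarrow>xs. f x y)"
    by metis
  have g_elem: "g (elem_tensor x y) = f x y" for x y
    using g[of "[(x, y)]"] by simp
  have "g (u + v) = g u + g v" for u v
  proof -
    obtain xs where u: "u = (\<Sum>(x, y)\<leftarrow>xs. elem_tensor x y)"
      by (rule alg_tensor_obtain)
    obtain ys where v: "v = (\<Sum>(x, y)\<leftarrow>ys. elem_tensor x y)"
      by (rule alg_tensor_obtain)
    from u v show ?thesis using g[of "xs @ ys"] g[of xs] g[of ys] by simp
  qed
  moreover have "g (c *\<^sub>C u) = c *\<^sub>C g u" for c u
  proof -
    obtain xs where u: "u = (\<Sum>(x, y)\<leftarrow>xs. elem_tensor x y)"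
      by (rule alg_tensor_obtain)
    let ?ys = "map (\<lambda>(x, y). (c *\<^sub>C x, y)) xs"
    have "c *\<^sub>C u = (\<Sum>(x, y)\<leftarrow>?ys. elem_tensor x y)"
      unfolding Rep_alg_tensor_inject[symmetric] Rep_sum_elem_tensor scaleC_alg_tensor.rep_eq u
      by (simp add: eval_tensor_scale fun_eq_iff)
    then have "g (c *\<^sub>C u) = (\<Sum>(x, y)\<leftarrow>?ys. f x y)" by (simp only: g)
    also have "\<dots> = c *\<^sub>C (\<Sum>(x, y)\<leftarrow>xs. f x y)"
      using f by (induction xs) (auto simp: scaleC_zero_right scaleC_add_right cbilinear_def clinear_iff)
    finally show ?thesis by (simp only: u g)
  qed
  ultimately have g_lin: "clinear g" by (simp add: clinear_iff)
  have "norm (g u) \<le> seminorm u * K" for u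
  proof (rule field_le_epsilon)
    fix e :: real assume "e > 0"
    then have "e / K > 0" using K_pos by simp
    then obtain xs where xs: "u = (\<Sum>(x, y)\<leftarrow>xs. elem_tensor x y)"
      "(\<Sum>(x, y)\<leftarrow>xs. norm x * norm y) < projective_norm u + e / K"
      using projective_norm_approx by blast
    have "norm (\<Sum>(x, y)\<leftarrow>xs. f x y) \<le> (\<Sum>(x, y)\<leftarrow>xs. norm x * norm y) * K"
    proof (induction xs)
      case (Cons p xs)
      obtain x y where p: "p = (x, y)" by (cases p)
      show ?case
        using Cons K[of x y] norm_triangle_ineq[of "f x y" "\<Sum>(x, y)\<leftarrow>xs. f x y"]
        by (simp add: p algebra_simps)
    qed simp
    also have "\<dots> \<le> (projective_norm u + e / K) * K"
      using xs(2) K_pos by simp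
    also have "\<dots> = seminorm u * K + e"
      using K_pos by (simp add: seminorm_alg_tensor_def algebra_simps)
    finally show "norm (g u) \<le> seminorm u * K + e" by (simp only: xs(1) g)
  qed
  from completion_extend[OF g_lin this] obtain L
    where L: "bounded_clinear L" "\<And>u. L (to_completion u) = g u" by blast
  show ?thesis
  proof (rule ex1I[of _ L])
    show "bounded_clinear L \<and> (\<forall>x y. L (x \<otimes>\<^sub>p y) = f x y)"
      by (simp add: L ptensor_def g_elem)
    fix L' assume L': "bounded_clinear L' \<and> (\<forall>x y. L' (x \<otimes>\<^sub>p y) = f x y)"
    then have lin: "clinear L'" by (simp add: bounded_clinear_def)
    show "L' = L"
    proof (rule completion_maps_eqI)
      fix u :: "('a, 'b) alg_tensor"
      obtain xs where u: "u = (\<Sum>(x, y)\<leftarrow>xs. elem_tensor x y)"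
        by (rule alg_tensor_obtain)
      have "L' (to_completion (\<Sum>(x, y)\<leftarrow>xs. elem_tensor x y)) = (\<Sum>(x, y)\<leftarrow>xs. f x y)"
        using L' by (induction xs)
          (auto simp: clinear_zero[OF clinear_to_completion] clinear_zero[OF lin] to_completion_add
            clinear_add[OF lin] ptensor_def)
      then show "L' (to_completion u) = L (to_completion u)"
        by (simp only: u L g)
    qed (use L' L in auto)
  qed
qed

lemma bounded_clinear_ptensor_lift: "bounded_cbilinear f \<Longrightarrow> bounded_clinear (ptensor_lift f)"
  and ptensor_lift_tensor: "bounded_cbilinear f \<Longrightarrow> ptensor_lift f (x \<otimes>\<^sub>p y) = f x y"
  using theI'[OF ptensor_universal, of f] unfolding ptensor_lift_def by blast+

lemma ptensor_eqI:
  fixes L L' :: "('a::complex_banach, 'b::complex_banach) ptensor \<Rightarrow> 'c::complex_banach"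
  assumes L: "bounded_clinear L" and L': "bounded_clinear L'"
    and eq: "\<And>x y. L (x \<otimes>\<^sub>p y) = L' (x \<otimes>\<^sub>p y)"
  shows "L = L'"
proof -
  have lin: "clinear L" and "\<exists>K. \<forall>\<xi>. norm (L \<xi>) \<le> norm \<xi> * K"
    using L by (auto simp: bounded_clinear_def)
  then obtain K where K: "\<And>\<xi>. norm (L \<xi>) \<le> norm \<xi> * K" by blast
  have "norm (L (x \<otimes>\<^sub>p y)) \<le> norm x * norm y * max K 0" for x y
  proof -
    have "norm (L (x \<otimes>\<^sub>p y)) \<le> norm (x \<otimes>\<^sub>p y) * max K 0"
      by (rule order_trans[OF K]) (simp add: mult_left_mono)
    also have "\<dots> \<le> norm x * norm y * max K 0"
      by (intro mult_right_mono norm_ptensor_le) simp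
    finally show ?thesis .
  qed
  then have "bounded_cbilinear (\<lambda>x y. L (x \<otimes>\<^sub>p y))"
    using lin unfolding bounded_cbilinear_def cbilinear_def clinear_iff
    by (auto simp: ptensor_simps)
  from ptensor_universal[OF this] show ?thesis
    using L L' eq by metis
qed


section \<open>Banach algebras and \<open>\<phi>\<close>-biprojectivity\<close>

text \<open>
  The product is an explicit argument, so that several Banach algebras can share one
  underlying Banach space. No unit is assumed.
\<close>

definition banach_algebra :: "('a::complex_banach \<Rightarrow> 'a \<Rightarrow> 'a) \<Rightarrow> bool" where
  "banach_algebra mul \<longleftrightarrow>
     cbilinear mul \<and>
     (\<forall>a b c. mul (mul a b) c = mul a (mul b c)) \<and>
     (\<forall>a b. norm (mul a b) \<le> norm a * norm b)"

definition twisted_mul :: "('a \<Rightarrow> 'a \<Rightarrow> 'a) \<Rightarrow> 'a \<Rightarrow> 'a \<Rightarrow> 'a \<Rightarrow> 'a" where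
  "twisted_mul mul e a b = mul (mul a e) b"

definition characters :: "('a::complex_banach \<Rightarrow> 'a \<Rightarrow> 'a) \<Rightarrow> ('a \<Rightarrow> complex) set" where
  "characters mul =
     {\<phi>. clinear \<phi> \<and> (\<forall>a b. \<phi> (mul a b) = \<phi> a * \<phi> b) \<and> \<phi> \<noteq> (\<lambda>a. 0)}"

definition bimodule_morphism ::
    "('a \<Rightarrow> 'x \<Rightarrow> 'x) \<Rightarrow> ('x \<Rightarrow> 'a \<Rightarrow> 'x) \<Rightarrow> ('a \<Rightarrow> 'y \<Rightarrow> 'y) \<Rightarrow> ('y \<Rightarrow> 'a \<Rightarrow> 'y) \<Rightarrow>
     ('x::complex_banach \<Rightarrow> 'y::complex_banach) \<Rightarrow> bool" where
  "bimodule_morphism lX rX lY rY T \<longleftrightarrow>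
     clinear T \<and> (\<forall>a x. T (lX a x) = lY a (T x)) \<and> (\<forall>a x. T (rX x a) = rY (T x) a)"

definition ptensor_lact ::
    "('a::complex_banach \<Rightarrow> 'a \<Rightarrow> 'a) \<Rightarrow> 'a \<Rightarrow> ('a, 'a) ptensor \<Rightarrow> ('a, 'a) ptensor" where
  "ptensor_lact mul a = ptensor_lift (\<lambda>b c. mul a b \<otimes>\<^sub>p c)"

definition ptensor_ract ::
    "('a::complex_banach \<Rightarrow> 'a \<Rightarrow> 'a) \<Rightarrow> ('a, 'a) ptensor \<Rightarrow> 'a \<Rightarrow> ('a, 'a) ptensor" where
  "ptensor_ract mul u a = ptensor_lift (\<lambda>b c. b \<otimes>\<^sub>p mul c a) u"

definition ptensor_mul :: "('a::complex_banach \<Rightarrow> 'a \<Rightarrow> 'a) \<Rightarrow> ('a, 'a) ptensor \<Rightarrow> 'a" where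
  "ptensor_mul mul = ptensor_lift mul"

definition phi_biprojective ::
    "('a::complex_banach \<Rightarrow> 'a \<Rightarrow> 'a) \<Rightarrow> ('a \<Rightarrow> complex) \<Rightarrow> bool" where
  "phi_biprojective mul \<phi> \<longleftrightarrow>
     (\<exists>\<rho> :: 'a \<Rightarrow> ('a, 'a) ptensor.
        bounded_clinear \<rho> \<and>
        bimodule_morphism mul mul (ptensor_lact mul) (ptensor_ract mul) \<rho> \<and>
        \<phi> \<circ> ptensor_mul mul \<circ> \<rho> = \<phi>)"

lemma bounded_cbilinear_mul:
  assumes "banach_algebra mul"
  shows "bounded_cbilinear mul"
  using assms unfolding banach_algebra_def bounded_cbilinear_def by (metis mult.right_neutral)

lemma ptensor_mul_tensor: "banach_algebra mul \<Longrightarrow> ptensor_mul mul (b \<otimes>\<^sub>p c) = mul b c"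
  by (simp add: ptensor_mul_def ptensor_lift_tensor bounded_cbilinear_mul)

lemma bounded_cbilinear_lact:
  assumes "banach_algebra mul"
  shows "bounded_cbilinear (\<lambda>b c. mul a b \<otimes>\<^sub>p c)"
  unfolding bounded_cbilinear_def
proof (intro conjI exI[of _ "norm a"] allI)
  show "cbilinear (\<lambda>b c. mul a b \<otimes>\<^sub>p c)"
    using assms unfolding banach_algebra_def cbilinear_def clinear_iff
    by (auto simp: ptensor_simps)
  fix b c
  have "norm (mul a b \<otimes>\<^sub>p c) \<le> norm (mul a b) * norm c" by (rule norm_ptensor_le)
  also have "\<dots> \<le> (norm a * norm b) * norm c"
    using assms by (intro mult_right_mono) (auto simp: banach_algebra_def)
  finally show "norm (mul a b \<otimes>\<^sub>p c) \<le> norm b * norm c * norm a" by (simp add: ac_simps)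
qed

lemma bounded_cbilinear_ract:
  assumes "banach_algebra mul"
  shows "bounded_cbilinear (\<lambda>b c. b \<otimes>\<^sub>p mul c a)"
  unfolding bounded_cbilinear_def
proof (intro conjI exI[of _ "norm a"] allI)
  show "cbilinear (\<lambda>b c. b \<otimes>\<^sub>p mul c a)"
    using assms unfolding banach_algebra_def cbilinear_def clinear_iff
    by (auto simp: ptensor_simps)
  fix b c
  have "norm (b \<otimes>\<^sub>p mul c a) \<le> norm b * norm (mul c a)" by (rule norm_ptensor_le)
  also have "\<dots> \<le> norm b * (norm c * norm a)"
    using assms by (intro mult_left_mono) (auto simp: banach_algebra_def)
  finally show "norm (b \<otimes>\<^sub>p mul c a) \<le> norm b * norm c * norm a" by (simp add: ac_simps)
qed

lemma ptensor_lact_tensor: "banach_algebra mul \<Longrightarrow> ptensor_lact mul a (b \<otimes>\<^sub>p c) = mul a b \<otimes>\<^sub>p c"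
  by (simp add: ptensor_lact_def ptensor_lift_tensor bounded_cbilinear_lact)

lemma ptensor_ract_tensor: "banach_algebra mul \<Longrightarrow> ptensor_ract mul (b \<otimes>\<^sub>p c) a = b \<otimes>\<^sub>p mul c a"
  by (simp add: ptensor_ract_def ptensor_lift_tensor bounded_cbilinear_ract)

lemma banach_algebra_twisted_mul:
  assumes A: "banach_algebra mul" and e: "norm e \<le> 1"
  shows "banach_algebra (twisted_mul mul e)"
  unfolding banach_algebra_def
proof (intro conjI allI)
  show "cbilinear (twisted_mul mul e)"
    using A by (auto simp: banach_algebra_def cbilinear_def clinear_iff twisted_mul_def)
  show "twisted_mul mul e (twisted_mul mul e a b) c = twisted_mul mul e a (twisted_mul mul e b c)" for a b c
    using A by (simp add: banach_algebra_def twisted_mul_def)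
  fix a b
  have n: "norm (mul x y) \<le> norm x * norm y" for x y using A by (simp add: banach_algebra_def)
  have "norm (mul (mul a e) b) \<le> norm (mul a e) * norm b" by (rule n)
  also have "\<dots> \<le> (norm a * norm e) * norm b" by (intro mult_right_mono n) simp
  also have "\<dots> \<le> (norm a * 1) * norm b" using e by (intro mult_right_mono mult_left_mono) simp_all
  finally show "norm (twisted_mul mul e a b) \<le> norm a * norm b" by (simp add: twisted_mul_def)
qed

lemma twisted_character:
  assumes "\<phi> \<in> characters mul" "\<phi> e \<noteq> 0"
  shows "(\<lambda>a. \<phi> e * \<phi> a) \<in> characters (twisted_mul mul e)"
  using assms by (auto simp: characters_def clinear_iff twisted_mul_def scaleC_complex_def
      fun_eq_iff algebra_simps)

end

theory Submission
  imports Defs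
begin

text \<open>
  If \<open>\<rho>\<close> witnesses \<open>\<phi>\<close>-biprojectivity of \<open>A\<close>, then \<open>\<rho>\<close> divided by \<open>\<phi> e\<close> witnesses
  \<open>\<psi>\<close>-biprojectivity of \<open>A\<^sub>e\<close>, where \<open>\<psi> = \<phi>(e)\<phi>\<close>.

  The module actions cause no difficulty, because acting with \<open>a\<close> in \<open>A\<^sub>e\<close> is acting in \<open>A\<close>
  with \<open>ae\<close> from the left and with \<open>ea\<close> from the right; so every bimodule morphism over \<open>A\<close> is
  one over \<open>A\<^sub>e\<close>. The normalisation comes from \<open>\<phi>(bec) = \<phi>(e)\<phi>(bc)\<close>, which says that
  \<open>\<phi> \<circ> \<pi>\<close> for \<open>A\<^sub>e\<close> is \<open>\<phi> e\<close> times \<open>\<phi> \<circ> \<pi>\<close> for \<open>A\<close> on elementary tensors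
  (\<open>character_ptensor_mul_twisted\<close>).

  Passing from elementary tensors to the completed tensor product needs \<open>\<phi>\<close> to be continuous.
  A character is only assumed to be linear and multiplicative, but completeness of the algebra
  makes it contractive (\<open>character_norm_le\<close>).
\<close>

text \<open>
  An element \<open>a\<close> with \<open>norm a < 1\<close> is quasi-invertible: \<open>b = a + ab\<close> has a solution, as the
  fixed point of a contraction. A value \<open>\<phi> a = 1\<close> would then give \<open>\<phi> b = 1 + \<phi> b\<close>.
\<close>

lemma character_ne_one:
  assumes A: "banach_algebra mul" and \<phi>: "\<phi> \<in> characters mul" and a: "norm a < 1"
  shows "\<phi> a \<noteq> 1"
proof
  assume one: "\<phi> a = 1"
  have bil: "cbilinear mul" and sub: "\<And>x y. norm (mul x y) \<le> norm x * norm y"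
    using A by (auto simp: banach_algebra_def)
  have lin: "clinear \<phi>" and mult: "\<And>x y. \<phi> (mul x y) = \<phi> x * \<phi> y"
    using \<phi> by (auto simp: characters_def)
  have "dist (a + mul a x) (a + mul a y) \<le> norm a * dist x y" for x y
  proof -
    have "mul a x - mul a y = mul a (x - y)"
      using bil by (simp add: cbilinear_def clinear_diff)
    then show ?thesis by (simp add: dist_norm sub)
  qed
  then have "\<exists>!b. a + mul a b = b"
    using a by (intro banach_fix_type[of "norm a"]) auto
  then obtain b where "a + mul a b = b" by blast
  then have "\<phi> a + \<phi> a * \<phi> b = \<phi> b"
    by (metis clinear_add[OF lin] mult)
  then show False by (simp add: one)
qed

lemma character_norm_le:
  assumes A: "banach_algebra mul" and \<phi>: "\<phi> \<in> characters mul"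
  shows "cmod (\<phi> a) \<le> norm a"
proof (rule ccontr)
  assume "\<not> cmod (\<phi> a) \<le> norm a"
  then have less: "norm a < cmod (\<phi> a)" and ne: "\<phi> a \<noteq> 0" by auto
  have "norm (inverse (\<phi> a) *\<^sub>C a) < 1"
    using less ne by (simp add: norm_scaleC norm_inverse norm_divide divide_simps)
  moreover have "\<phi> (inverse (\<phi> a) *\<^sub>C a) = 1"
    using \<phi> ne by (simp add: characters_def clinear_iff scaleC_complex_def)
  ultimately show False
    using character_ne_one[OF A \<phi>] by blast
qed

lemma bounded_clinear_character:
  assumes "banach_algebra mul" "\<phi> \<in> characters mul"
  shows "bounded_clinear \<phi>"
  using assms character_norm_le[OF assms] unfolding bounded_clinear_def characters_def
  by (metis (no_types, lifting) mem_Collect_eq mult.right_neutral)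

lemma bounded_clinear_compose:
  assumes f: "bounded_clinear f" and g: "bounded_clinear g"
  shows "bounded_clinear (\<lambda>x. f (g x))"
proof -
  have "bounded_linear (\<lambda>x. f (g x))"
    using f g by (intro bounded_linear_compose[of f g] bounded_clinear_imp_bounded_linear)
  then show ?thesis
    using f g unfolding bounded_clinear_def clinear_iff by (auto dest: bounded_linear.bounded)
qed

lemma bounded_clinear_scaleC:
  "bounded_clinear ((*\<^sub>C) c :: 'a \<Rightarrow> 'a::complex_normed_vector)"
  unfolding bounded_clinear_def clinear_iff
  by (auto simp: scaleC_add_right scaleC_scaleC norm_scaleC mult.commute
      intro!: exI[of _ "cmod c"])

lemma ptensor_lact_twisted_mul:
  "ptensor_lact (twisted_mul mul e) a = ptensor_lact mul (mul a e)"
  by (simp add: ptensor_lact_def twisted_mul_def)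

lemma ptensor_ract_twisted_mul:
  assumes "banach_algebra mul"
  shows "ptensor_ract (twisted_mul mul e) u a = ptensor_ract mul u (mul e a)"
  using assms by (simp add: ptensor_ract_def twisted_mul_def banach_algebra_def)

text \<open>
  Both sides are bounded linear in \<open>u\<close>, so it suffices to compare them on elementary tensors
  \<open>b \<otimes>\<^sub>p c\<close>, where the identity is \<open>\<phi>(bec) = \<phi>(e)\<phi>(bc)\<close>.
\<close>

lemma character_ptensor_mul_twisted:
  assumes A: "banach_algebra mul" and \<phi>: "\<phi> \<in> characters mul" and e: "norm e \<le> 1"
  shows "\<phi> (ptensor_mul (twisted_mul mul e) u) = \<phi> e * \<phi> (ptensor_mul mul u)"
proof -
  have Ae: "banach_algebra (twisted_mul mul e)"
    by (rule banach_algebra_twisted_mul[OF A e])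
  have \<pi>: "bounded_clinear (ptensor_mul m)" if "banach_algebra m" for m :: "'a \<Rightarrow> 'a \<Rightarrow> 'a"
    unfolding ptensor_mul_def by (intro bounded_clinear_ptensor_lift bounded_cbilinear_mul that)
  have "(\<lambda>u. \<phi> (ptensor_mul (twisted_mul mul e) u)) = (\<lambda>u. \<phi> e *\<^sub>C \<phi> (ptensor_mul mul u))"
  proof (rule ptensor_eqI)
    show "bounded_clinear (\<lambda>u. \<phi> (ptensor_mul (twisted_mul mul e) u))"
      by (intro bounded_clinear_compose[OF bounded_clinear_character[OF A \<phi>]] \<pi> Ae)
    show "bounded_clinear (\<lambda>u. \<phi> e *\<^sub>C \<phi> (ptensor_mul mul u))"
      by (intro bounded_clinear_compose[OF bounded_clinear_scaleC]
          bounded_clinear_compose[OF bounded_clinear_character[OF A \<phi>]] \<pi> A)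
    show "\<phi> (ptensor_mul (twisted_mul mul e) (b \<otimes>\<^sub>p c)) = \<phi> e *\<^sub>C \<phi> (ptensor_mul mul (b \<otimes>\<^sub>p c))" for b c
      using \<phi> by (simp add: ptensor_mul_tensor A Ae twisted_mul_def characters_def scaleC_complex_def)
  qed
  then show ?thesis by (simp add: fun_eq_iff scaleC_complex_def)
qed

theorem theorem2p6:
  fixes mul :: "'a::complex_banach \<Rightarrow> 'a \<Rightarrow> 'a"
    and \<phi> :: "'a \<Rightarrow> complex"
    and e :: 'a
  assumes "banach_algebra mul"
    and "\<phi> \<in> characters mul"
    and "norm e \<le> 1"
    and "\<phi> e \<noteq> 0"
    and "phi_biprojective mul \<phi>"
  shows "phi_biprojective (twisted_mul mul e) (\<lambda>a. \<phi> e * \<phi> a)"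
proof -
  note A = assms(1) and \<phi> = assms(2)
  obtain \<rho> :: "'a \<Rightarrow> ('a, 'a) ptensor" where \<rho>: "bounded_clinear \<rho>"
    and mor: "bimodule_morphism mul mul (ptensor_lact mul) (ptensor_ract mul) \<rho>"
    and \<phi>\<rho>: "\<And>a. \<phi> (ptensor_mul mul (\<rho> a)) = \<phi> a"
    using assms(5) by (auto simp: phi_biprojective_def fun_eq_iff)
  have \<rho>_left: "\<rho> (mul a x) = ptensor_lact mul a (\<rho> x)"
    and \<rho>_right: "\<rho> (mul x a) = ptensor_ract mul (\<rho> x) a" for a x
    using mor by (auto simp: bimodule_morphism_def)
  define k where "k = inverse (\<phi> e)"
  define \<rho>' where "\<rho>' = (\<lambda>a. k *\<^sub>C \<rho> a)"
  have \<rho>': "bounded_clinear \<rho>'"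
    unfolding \<rho>'_def by (rule bounded_clinear_compose[OF bounded_clinear_scaleC \<rho>])
  have "bounded_clinear (ptensor_lact mul a)" for a
    unfolding ptensor_lact_def by (intro bounded_clinear_ptensor_lift bounded_cbilinear_lact A)
  then have lact_scaleC: "ptensor_lact mul a (k *\<^sub>C u) = k *\<^sub>C ptensor_lact mul a u" for a u
    by (simp add: bounded_clinear_def clinear_iff)
  have "bounded_clinear (\<lambda>u. ptensor_ract mul u a)" for a
    unfolding ptensor_ract_def by (intro bounded_clinear_ptensor_lift bounded_cbilinear_ract A)
  then have ract_scaleC: "ptensor_ract mul (k *\<^sub>C u) a = k *\<^sub>C ptensor_ract mul u a" for a u
    by (simp add: bounded_clinear_def clinear_iff)
  have twisted_right: "twisted_mul mul e x a = mul x (mul e a)" for x a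
    using A by (simp add: twisted_mul_def banach_algebra_def)
  have left: "\<rho>' (twisted_mul mul e a x) = ptensor_lact (twisted_mul mul e) a (\<rho>' x)" for a x
    by (simp add: \<rho>'_def ptensor_lact_twisted_mul lact_scaleC \<rho>_left twisted_mul_def)
  have right: "\<rho>' (twisted_mul mul e x a) = ptensor_ract (twisted_mul mul e) (\<rho>' x) a" for a x
    by (simp add: \<rho>'_def ptensor_ract_twisted_mul[OF A] ract_scaleC \<rho>_right twisted_right)
  have "bimodule_morphism (twisted_mul mul e) (twisted_mul mul e)
      (ptensor_lact (twisted_mul mul e)) (ptensor_ract (twisted_mul mul e)) \<rho>'"
    using \<rho>' left right by (simp add: bimodule_morphism_def bounded_clinear_def)
  moreover have "\<phi> (ptensor_mul (twisted_mul mul e) (\<rho>' a)) = \<phi> a" for a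
  proof -
    have "bounded_clinear (\<lambda>u. \<phi> (ptensor_mul mul u))"
      unfolding ptensor_mul_def
      by (intro bounded_clinear_compose[OF bounded_clinear_character[OF A \<phi>]]
          bounded_clinear_ptensor_lift bounded_cbilinear_mul A)
    then have "\<phi> (ptensor_mul mul (\<rho>' a)) = k * \<phi> a"
      by (simp add: \<rho>'_def bounded_clinear_def clinear_iff scaleC_complex_def \<phi>\<rho>)
    then show ?thesis
      using assms(4) by (simp add: character_ptensor_mul_twisted[OF A \<phi> assms(3)] k_def)
  qed
  ultimately show ?thesis
    using \<rho>' unfolding phi_biprojective_def
    by (intro exI[of _ \<rho>']) (auto simp: fun_eq_iff)
qed

end
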